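(* Let $k\ge 1$ and $n\ge 0$ be integers, and let $B_n$ be the perfect binary tree in which every leaf has height (distance from the root) $n$. If the vertices of $B_n$ are colored uniformly and independently with $k$ colors, the expected number of blocks is $$\mathbb{E}[X_{k}(B_n)] = \frac{k+2(k-1)(2^{n}-1)}{k}.$$
   Context: Given a coloring of the vertices of a finite graph $G$ with $k$ colors, the blocks are the connected components of the subgraph of $G$ formed by all vertices and all edges whose two endpoints have the same color. $X_k(G)$ denotes the number of blocks when each vertex of $G$ receives independently a uniformly random color among $k$ colors. A perfect binary tree is a rooted tree in which every vertex has either $0$ or $2$ children and all leaves are at the same height (the one-vertex tree for height $0$). *)

theory Defs
  imports "HOL-Probability.Product_PMF" "Graph_Theory.Graph_Theory"
begin

text \<open>
  Undirected graphs are symmetric digraphs (locale \<^locale>\<open>graph\<close>: finite, without loops and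
  parallel arcs), each edge being represented by a pair of opposite arcs. Hence the library's
  \<^const>\<open>forest\<close> and \<^const>\<open>tree\<close> are unsuitable here: traversing an edge forth and back is a
  \<^const>\<open>pre_digraph.cycle\<close> of length 2. Undirected cycles are the cycles of length at least 3.
\<close>

definition undirected_tree :: "('a, 'b) pre_digraph \<Rightarrow> bool" where
  "undirected_tree G \<longleftrightarrow> graph G \<and> Digraph_Component.connected G \<and>
     \<not> (\<exists>p. pre_digraph.cycle G p \<and> length p \<ge> 3)"

definition graph_dist :: "('a, 'b) pre_digraph \<Rightarrow> 'a \<Rightarrow> 'a \<Rightarrow> nat" where
  "graph_dist G u v = (LEAST l. \<exists>p. pre_digraph.awalk G u p v \<and> length p = l)"

definition children :: "('a, 'b) pre_digraph \<Rightarrow> 'a \<Rightarrow> 'a \<Rightarrow> 'a set" where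
  "children G r u = {v. u \<rightarrow>\<^bsub>G\<^esub> v \<and> graph_dist G r v = graph_dist G r u + 1}"

definition perfect_binary_tree :: "('a, 'b) pre_digraph \<Rightarrow> 'a \<Rightarrow> nat \<Rightarrow> bool" where
  "perfect_binary_tree G r n \<longleftrightarrow> undirected_tree G \<and> r \<in> verts G \<and>
     (\<forall>u\<in>verts G. card (children G r u) = 0 \<or> card (children G r u) = 2) \<and>
     (\<forall>u\<in>verts G. children G r u = {} \<longrightarrow> graph_dist G r u = n)"

lemma perfect_binary_tree_exists:
  "\<exists>(B :: (bool list, bool list \<times> bool list) pre_digraph) r. perfect_binary_tree B r n"
proof -
  define A where "A = {(xs, b # xs) | b (xs :: bool list). length xs < n}"
  define B where "B = \<lparr>verts = {xs :: bool list. length xs \<le> n}, arcs = A \<union> A\<inverse>,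
    tail = fst, head = snd\<rparr>"
  have B: "verts B = {xs. length xs \<le> n}" "arcs B = A \<union> A\<inverse>" "tail B = fst" "head B = snd"
    by (simp_all add: B_def)
  have ends: "arcs_ends B = A \<union> A\<inverse>"
    by (simp add: arcs_ends_conv B)
  have fin: "finite (verts B)"
    using finite_lists_length_le[of "UNIV :: bool set" n] by (simp add: B)
  interpret wf_digraph B
    by unfold_locales (auto simp: B A_def)
  have "arcs B \<subseteq> verts B \<times> verts B" by (auto simp: B A_def)
  then have "finite (arcs B)" using fin by (meson finite_SigmaI finite_subset)
  then interpret graph B
    using fin
    by unfold_locales
       (auto simp: B A_def arc_to_ends_def symmetric_def ends sym_Un_converse)
  have to: "\<exists>p. awalk [] p v \<and> length p = length v" if "length v \<le> n" for v
    using that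
  proof (induction v)
    case Nil
    then show ?case by (auto simp: awalk_Nil_iff B intro!: exI[of _ "[]"])
  next
    case (Cons b v)
    then obtain p where p: "awalk [] p v" "length p = length v" by auto
    have "awalk v [(v, b # v)] (b # v)"
      using Cons.prems by (auto simp: awalk_Cons_iff awalk_Nil_iff B A_def)
    with p show ?case
      by (intro exI[of _ "p @ [(v, b # v)]"]) (auto intro: awalk_appendI)
  qed
  have lb: "length v \<le> length u + length p" if "awalk u p v" for u v p
    using that by (induction p arbitrary: u) (fastforce simp: awalk_Cons_iff awalk_Nil_iff B A_def)+
  have dist: "graph_dist B [] v = length v" if "length v \<le> n" for v
    unfolding graph_dist_def using to[OF that] lb[of "[]" _ v] by (intro Least_equality) auto
  have ch: "children B [] u = (if length u < n then {True # u, False # u} else {})"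
    if "length u \<le> n" for u
    using that by (auto simp: children_def ends A_def dist)
  have conn: "Digraph_Component.connected B"
  proof -
    have "[] \<rightarrow>\<^sup>*\<^bsub>B\<^esub> v" if "v \<in> verts B" for v
      using to[of v] that by (auto simp: B reachable_awalk)
    note root = this
    have "u \<rightarrow>\<^sup>*\<^bsub>B\<^esub> v" if "u \<in> verts B" "v \<in> verts B" for u v
      using symmetric_reachable[OF sym_arcs root[OF that(1)]] root[OF that(2)]
      by (rule reachable_trans)
    moreover have "verts B \<noteq> {}" by (auto simp: B intro: exI[of _ "[]"])
    ultimately show ?thesis
      by (intro connectedI) (simp_all add: reachable_mk_symmetricI)
  qed
  have acyc: "\<not> (\<exists>p. cycle p \<and> length p \<ge> 3)"
  proof
    assume "\<exists>p. cycle p \<and> length p \<ge> 3"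
    then obtain p u where p: "awalk u p u" "distinct (tl (awalk_verts u p))" "length p \<ge> 3"
      by (auto simp: cycle_def)
    define w where "w = (!) (awalk_verts u p)"
    let ?m = "length p"
    have len: "length (awalk_verts u p) = Suc ?m" by (rule length_awalk_verts)
    have step: "(awalk_verts u p ! i, awalk_verts u p ! Suc i) \<in> A \<union> A\<inverse>"
      if "awalk u p v" "i < length p" for u v p i
      using that
    proof (induction p arbitrary: u i)
      case (Cons e p)
      then have e: "e \<in> A \<union> A\<inverse>" "fst e = u" "awalk (snd e) p v"
        by (auto simp: awalk_Cons_iff B)
      have "awalk_verts (snd e) p ! 0 = snd e"
        using e(3) by (cases p) (auto simp: awalk_Cons_iff)
      then show ?case
        using e Cons.IH[OF e(3)] Cons.prems(2) by (cases i) (auto simp: B)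
    qed simp
    have adj: "(w i, w (Suc i)) \<in> A \<union> A\<inverse>" "(w (Suc i), w i) \<in> A \<union> A\<inverse>" if "i < ?m" for i
      using step[OF p(1) that] by (auto simp: w_def)
    have up: "y = tl x" if "(x, y) \<in> A \<union> A\<inverse>" "length y \<le> length x" for x y
      using that by (auto simp: A_def)
    have "w 0 = u" "w ?m = u"
      using awhd_of_awalk[OF p(1)] awlast_of_awalk[OF p(1)] len
      by (simp_all add: w_def hd_conv_nth last_conv_nth)
    then have w0: "w 0 = w ?m" by simp
    have inj: "i = j" if "w i = w j" "i \<in> {1..?m}" "j \<in> {1..?m}" for i j
    proof -
      have "tl (awalk_verts u p) ! (i - 1) = tl (awalk_verts u p) ! (j - 1)"
        using that len by (auto simp: w_def nth_tl)
      then have "i - 1 = j - 1"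
        using p(2) that len by (subst (asm) nth_eq_iff_index_eq) auto
      then show ?thesis using that by auto
    qed
    obtain j where j: "j \<in> {1..?m}" "\<And>i. i \<in> {1..?m} \<Longrightarrow> length (w i) \<le> length (w j)"
    proof -
      have "finite ((\<lambda>i. length (w i)) ` {1..?m})" "(\<lambda>i. length (w i)) ` {1..?m} \<noteq> {}"
        using p(3) by auto
      from Max_in[OF this] Max_ge[OF this(1)] show ?thesis using that
        by (smt (verit, best) imageE image_eqI)
    qed
    define i where "i = (if j = 1 then ?m else j - 1)"
    define l where "l = (if j = ?m then 1 else j + 1)"
    have il: "i \<in> {1..?m}" "l \<in> {1..?m}" using j(1) p(3) by (auto simp: i_def l_def)
    have "w i = w (j - 1)" using w0 by (simp add: i_def)
    moreover have "j - 1 < ?m" "Suc (j - 1) = j" using j(1) by auto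
    ultimately have "(w j, w i) \<in> A \<union> A\<inverse>" using adj(2)[of "j - 1"] by simp
    then have "w i = tl (w j)" by (rule up) (rule j(2)[OF il(1)])
    moreover have "(w j, w l) \<in> A \<union> A\<inverse>"
    proof (cases "j = ?m")
      case True
      have "(w 0, w (Suc 0)) \<in> A \<union> A\<inverse>" using p(3) by (intro adj(1)) linarith
      then show ?thesis unfolding w0 using True by (simp add: l_def)
    next
      case False
      then have "j < ?m" using j(1) by auto
      then show ?thesis using adj(1)[of j] by (simp add: l_def)
    qed
    then have "w l = tl (w j)" by (rule up) (rule j(2)[OF il(2)])
    ultimately have "i = l" using inj il by metis
    then show False using p(3) j(1) by (auto simp: i_def l_def split: if_splits)
  qed
  have "perfect_binary_tree B [] n"
    unfolding perfect_binary_tree_def undirected_tree_def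
    using conn acyc graph_axioms ch dist
    by (auto simp: B intro!: graph.intro)
  then show ?thesis by blast
qed

definition monochromatic_subgraph :: "('a, 'b) pre_digraph \<Rightarrow> ('a \<Rightarrow> 'c) \<Rightarrow> ('a, 'b) pre_digraph"
  where "monochromatic_subgraph G c =
    \<lparr>verts = verts G, arcs = {e \<in> arcs G. c (tail G e) = c (head G e)},
     tail = tail G, head = head G\<rparr>"

definition blocks :: "('a, 'b) pre_digraph \<Rightarrow> ('a \<Rightarrow> 'c) \<Rightarrow> ('a, 'b) pre_digraph set" where
  "blocks G c =
    {H. pre_digraph.max_subgraph (monochromatic_subgraph G c) Digraph_Component.connected H}"

text \<open>
  Colorings are functions on the whole vertex type that take the irrelevant value 0 outside of
  \<^term>\<open>verts G\<close>. For \<open>k = 0\<close> the distribution is unspecified.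
\<close>

definition random_coloring :: "nat \<Rightarrow> ('a, 'b) pre_digraph \<Rightarrow> ('a \<Rightarrow> nat) pmf" where
  "random_coloring k G = Pi_pmf (verts G) 0 (\<lambda>_. pmf_of_set {..<k})"

definition expected_blocks :: "nat \<Rightarrow> ('a, 'b) pre_digraph \<Rightarrow> real" where
  "expected_blocks k G =
     measure_pmf.expectation (random_coloring k G) (\<lambda>c. real (card (blocks G c)))"

end

theory Submission
  imports Defs
begin

text \<open>
  Root the tree. Every block has a unique vertex closest to the root, and these are the root itself
  and the vertices coloured differently from their parent. A non-root vertex differs in colour
  from its parent with probability \<open>1 - 1/k\<close>, so by linearity the expectation is
  \<open>1 + (m - 1) (1 - 1/k)\<close> for every tree with \<open>m\<close> vertices; a perfect binary tree of height \<open>n\<close>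
  has \<open>2^(n+1) - 1\<close> of them.
\<close>

section \<open>Components of symmetric digraphs\<close>

context sym_digraph
begin

text \<open>A subgraph may contain an arc without its opposite, so \<open>H\<close> itself can fail
  to be strongly connected. The induced subgraph on \<open>verts H\<close> is symmetric and has
  \<open>H\<close> as a connected spanning subgraph.\<close>

lemma connected_imp_strongly_connected_induce:
  assumes "subgraph H G" "Digraph_Component.connected H"
  shows "strongly_connected (G \<restriction> verts H)"
proof -
  have sub: "verts H \<subseteq> verts G" using assms(1) by auto
  interpret H: wf_digraph "G \<restriction> verts H" by (rule wellformed_induce_subgraph)
  have "spanning H (G \<restriction> verts H)"
    using assms(1) by (auto simp: spanning_def intro: subgraph_induce_subgraphI2)
  then have "Digraph_Component.connected (G \<restriction> verts H)"
    using assms(2) by (rule H.connected_spanning_imp_connected)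
  moreover have "symmetric (G \<restriction> verts H)"
    using sub by (intro induced_graph_imp_symmetric[OF sym_arcs] induced_induce)
  ultimately show ?thesis by (rule H.symmetric_connected_imp_strongly_connected[rotated])
qed

text \<open>Makes the theory of \<open>sccs\<close> available for blocks. Strong connectivity
  implies connectivity, and every connected subgraph sits inside a strongly connected one on the
  same vertices, so the maximal ones coincide.\<close>

lemma max_connected_subgraphs_eq_sccs: "{H. max_subgraph Digraph_Component.connected H} = sccs"
proof -
  \<comment> \<open>\<open>connected\<close> asks for reachability in the symmetric closure, which
    contains the arcs of \<open>H\<close>; monotonicity suffices.\<close>
  have sc: "Digraph_Component.connected H" if "strongly_connected H"
    for H :: "('a, 'b) pre_digraph"
    using that rtrancl_on_mono[of "arcs_ends H" "(arcs_ends H)\<^sup>s" "verts H" "verts H"]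
    unfolding connected_conv strongly_connected_def reachable_def by (auto simp: symcl_def)
  have ind: "G \<restriction> verts H = H" 
    if "subgraph H G" "Digraph_Component.connected H" 
      "\<And>H'. subgraph H H' \<Longrightarrow> subgraph H' G \<Longrightarrow> strongly_connected H' \<Longrightarrow> H' = H" for H
    using that connected_imp_strongly_connected_induce[OF that(1,2)]
    by (meson subgraph_induce_subgraphI subgraph_induce_subgraphI2 subgraphE)
  show ?thesis
    unfolding sccs_altdef2
  proof (intro set_eqI iffI CollectI; elim CollectE)
    fix H assume H: "max_subgraph Digraph_Component.connected H"
    then have "G \<restriction> verts H = H" using sc by (intro ind) (auto simp: max_subgraph_def)
    then have "strongly_connected H"
      using connected_imp_strongly_connected_induce[of H] H by (auto simp: max_subgraph_def)
    then show "max_subgraph strongly_connected H"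
      using H sc by (blast intro: max_subgraph_mp)
  next
    fix H assume H: "max_subgraph strongly_connected H"
    \<comment> \<open>\<open>H'\<close> lies between \<open>H\<close> and the subgraph induced by
      \<open>verts H'\<close>, and the latter equals \<open>H\<close> by maximality.\<close>
    have "H' = H" if "subgraph H H'" "subgraph H' G" "Digraph_Component.connected H'" for H'
    proof -
      have *: "subgraph H' (G \<restriction> verts H')" "subgraph (G \<restriction> verts H') G"
        using that(2) by (auto intro: subgraph_induce_subgraphI subgraph_induce_subgraphI2)
      then have "G \<restriction> verts H' = H"
        using H that connected_imp_strongly_connected_induce[OF that(2,3)] subgraph_trans
        unfolding max_subgraph_def by metis
      then show ?thesis using * that(1)
        by (auto simp: subgraph_def compatible_def intro!: pre_digraph.equality)
    qed
    then show "max_subgraph Digraph_Component.connected H"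
      using H sc by (auto simp: max_subgraph_def)
  qed
qed

text \<open>\<open>f\<close> is constant on each component and maps every vertex into its own
  component, so its nonempty fibres are exactly the components.\<close>

lemma card_sccs_eq_card_representatives:
  assumes arc: "\<And>u v. u \<rightarrow>\<^bsub>G\<^esub> v \<Longrightarrow> f u = f v"
    and reach: "\<And>v. v \<in> verts G \<Longrightarrow> v \<rightarrow>\<^sup>*\<^bsub>G\<^esub> f v"
  shows "card sccs = card (f ` verts G)"
proof -
  have const: "f u = f v" if "u \<rightarrow>\<^sup>*\<^bsub>G\<^esub> v" for u v
    using that by (induction rule: reachable_induct) (auto simp: arc)
  have symr: "v \<rightarrow>\<^sup>*\<^bsub>G\<^esub> u" if "u \<rightarrow>\<^sup>*\<^bsub>G\<^esub> v" for u v
    using symmetric_reachable[OF sym_arcs that] .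
  have iff: "u \<rightarrow>\<^sup>*\<^bsub>G\<^esub> v \<longleftrightarrow> f u = f v" if "u \<in> verts G" "v \<in> verts G" for u v
    using const reach[OF that(1)] symr[OF reach[OF that(2)]] reachable_trans by metis
  have "bij_betw (\<lambda>x. {v \<in> verts G. f v = x}) (f ` verts G) sccs_verts"
  proof (rule bij_betw_imageI)
    show "inj_on (\<lambda>x. {v \<in> verts G. f v = x}) (f ` verts G)"
      by (rule inj_onI) blast
    show "(\<lambda>x. {v \<in> verts G. f v = x}) ` (f ` verts G) = sccs_verts"
    proof (intro equalityI subsetI)
      fix S assume "S \<in> (\<lambda>x. {v \<in> verts G. f v = x}) ` (f ` verts G)"
      then obtain u where "u \<in> verts G" "S = {v \<in> verts G. f v = f u}" by auto
      then show "S \<in> sccs_verts"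
        by (auto simp: in_sccs_verts_conv_reachable iff dest: const reachable_in_verts)
    next
      fix S assume S: "S \<in> sccs_verts"
      then obtain u where u: "u \<in> S" by (auto simp: in_sccs_verts_conv_reachable)
      then have uv: "u \<in> verts G"
        using S reachable_in_verts(1)[of u u] by (auto simp: in_sccs_verts_conv_reachable)
      have "S = {v. u \<rightarrow>\<^sup>*\<^bsub>G\<^esub> v}"
        using S u symr unfolding in_sccs_verts_conv_reachable by blast
      also have "\<dots> = {v \<in> verts G. f v = f u}"
        using iff[OF uv] reachable_in_verts(2)[of u] by (intro Collect_cong) metis
      finally show "S \<in> (\<lambda>x. {v \<in> verts G. f v = x}) ` (f ` verts G)" using uv by blast
    qed
  qed
  then show ?thesis by (simp add: bij_betw_same_card card_sccs_verts)
qed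

end

section \<open>Walks in acyclic graphs\<close>

text \<open>Otherwise the walk shortens to a path with at least two arcs, and the arc from
  \<open>v\<close> back to \<open>u\<close> closes it to a cycle of length at least 3.\<close>

lemma undirected_tree_awalk_uses_arc:
  assumes T: "undirected_tree G" and uv: "u \<rightarrow>\<^bsub>G\<^esub> v" and p: "pre_digraph.awalk G u p v"
  shows "\<exists>e\<in>set p. tail G e = u \<and> head G e = v"
proof (rule ccontr)
  assume *: "\<not> ?thesis"
  interpret graph G using T by (simp add: undirected_tree_def)
  define q where "q = awalk_to_apath p"
  have q: "apath u q v" "set q \<subseteq> set p"
    using p by (auto simp: q_def apath_awalk_to_apath dest: awalk_to_apath_subset)
  have "u \<noteq> v" using uv adj_not_same by blast
  have "length q \<ge> 2"
  proof (cases q)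
    case Nil then show ?thesis using q(1) \<open>u \<noteq> v\<close> by (simp add: apath_Nil_iff)
  next
    case (Cons e q')
    then show ?thesis using q * by (cases q') (auto simp: apath_simps)
  qed
  moreover obtain e where e: "e \<in> arcs G" "tail G e = v" "head G e = u"
    using graph_symmetric[OF uv] by (auto simp: arcs_ends_conv)
  moreover have "awalk v (e # q) v" "distinct (tl (awalk_verts v (e # q)))"
    using e q(1) by (simp_all add: awalk_Cons_iff apath_def)
  then have "cycle (e # q)" by (auto simp: cycle_def)
  ultimately have "cycle (e # q) \<and> length (e # q) \<ge> 3" by simp
  then show False using T by (auto simp: undirected_tree_def)
qed


section \<open>Counting blocks in a rooted tree\<close>

text \<open>The tree is encoded by parent pointers; since \<open>depth\<close> drops at each step,
  climbing along \<open>par\<close> ends at \<open>r\<close>.\<close>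

locale rooted_tree = graph G for G :: "('a, 'b) pre_digraph" +
  fixes r :: 'a and par :: "'a \<Rightarrow> 'a" and depth :: "'a \<Rightarrow> nat"
  assumes root: "r \<in> verts G"
    and par_in_verts: "v \<in> verts G - {r} \<Longrightarrow> par v \<in> verts G"
    and depth_par: "v \<in> verts G - {r} \<Longrightarrow> depth v = Suc (depth (par v))"
    and adj_iff: "u \<rightarrow>\<^bsub>G\<^esub> v \<longleftrightarrow>
      v \<in> verts G - {r} \<and> u = par v \<or> u \<in> verts G - {r} \<and> v = par u"
begin

text \<open>Sending each vertex to the top of its block is constant along monochromatic edges, so
  the number of blocks is the number of tops.\<close>

lemma card_blocks: "card (blocks G c) = Suc (card {v \<in> verts G - {r}. c v \<noteq> c (par v)})"
proof -
  define M where "M = monochromatic_subgraph G c"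
  have M: "verts M = verts G" "arcs M = {e \<in> arcs G. c (tail G e) = c (head G e)}"
    "tail M = tail G" "head M = head G"
    by (simp_all add: M_def monochromatic_subgraph_def)
  have adj: "u \<rightarrow>\<^bsub>M\<^esub> v \<longleftrightarrow> u \<rightarrow>\<^bsub>G\<^esub> v \<and> c u = c v" for u v
    by (auto simp: arcs_ends_conv M)
  interpret M: sym_digraph M
  proof
    show "symmetric M"
      unfolding symmetric_def using adj graph_symmetric by (auto intro!: symI)
  qed (auto simp: M)
  define T where "T = insert r {v \<in> verts G - {r}. c v \<noteq> c (par v)}"
  \<comment> \<open>Iterating \<open>g\<close> climbs inside the block and stabilises at its top vertex.\<close>
  define g where "g v = (if v \<in> T then v else par v)" for v
  \<comment> \<open>\<open>N\<close> steps suffice from every vertex, and surplus steps are harmless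
    because \<open>g\<close> fixes \<open>T\<close>.\<close>
  define N where "N = Max (depth ` verts G)"
  define top where "top = g ^^ N"
  have fixed: "(g ^^ m) v = v" if "v \<in> T" for m v
    using that by (induction m) (auto simp: g_def)
  have in_T: "(g ^^ m) v \<in> T" if "v \<in> verts G" "depth v \<le> m" for m v
    using that
  proof (induction m arbitrary: v)
    case 0
    then have "v = r" using depth_par[of v] by auto
    then show ?case by (simp add: T_def)
  next
    case (Suc m)
    show ?case
    proof (cases "v \<in> T")
      case True then show ?thesis using fixed[of v "Suc m"] by simp
    next
      case False
      then have "v \<in> verts G - {r}" using Suc.prems by (auto simp: T_def)
      then show ?thesis
        using Suc.IH[of "par v"] Suc.prems par_in_verts depth_par False
        by (simp add: funpow_Suc_right g_def del: funpow.simps)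
    qed
  qed
  have top_in: "top v \<in> T" if "v \<in> verts G" for v
    using that by (auto simp: top_def N_def intro!: in_T)
  have top_par: "top (par v) = top v" if "v \<in> verts G - {r}" "c (par v) = c v" for v
  proof -
    have "g v = par v" using that by (auto simp: g_def T_def)
    \<comment> \<open>An extra \<open>g\<close> commutes past the iterate and is then absorbed,
      because \<open>top v\<close> is a fixed point.\<close>
    then have "top (par v) = g (top v)" by (simp add: top_def funpow_swap1)
    also have "\<dots> = top v" using top_in[of v] that by (simp add: g_def)
    finally show ?thesis .
  qed
  have reach_g: "g v \<in> verts M \<and> v \<rightarrow>\<^sup>*\<^bsub>M\<^esub> g v" if "v \<in> verts M" for v
  proof (cases "v \<in> T")
    case False
    then have "v \<in> verts G - {r}" "c v = c (par v)" using that by (auto simp: T_def M)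
    then have "v \<rightarrow>\<^bsub>M\<^esub> par v" by (simp add: adj adj_iff)
    then show ?thesis using False M.adj_in_verts(2) by (auto simp: g_def)
  qed (use that in \<open>simp add: g_def\<close>)
  have reach: "(g ^^ m) v \<in> verts M \<and> v \<rightarrow>\<^sup>*\<^bsub>M\<^esub> (g ^^ m) v" if "v \<in> verts M" for m v
    using that by (induction m) (auto dest: reach_g intro: M.reachable_trans)
  have "card (blocks G c) = card M.sccs"
    by (simp add: blocks_def M.max_connected_subgraphs_eq_sccs flip: M_def)
  also have "\<dots> = card (top ` verts M)"
  proof (rule M.card_sccs_eq_card_representatives)
    show "top u = top v" if "u \<rightarrow>\<^bsub>M\<^esub> v" for u v
      using that top_par[of u] top_par[of v] by (auto simp: adj adj_iff)
  qed (use reach in \<open>simp add: top_def\<close>)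
  also have "top ` verts M = T"
  proof
    show "T \<subseteq> top ` verts M"
    proof
      fix v assume "v \<in> T"
      then have "v = top v" "v \<in> verts M" using fixed root by (auto simp: top_def T_def M)
      then show "v \<in> top ` verts M" by blast
    qed
  qed (use top_in M in auto)
  finally show ?thesis by (simp add: T_def)
qed

end

section \<open>Expectation for a random coloring\<close>

text \<open>Fix all colors except that of \<open>v\<close>: the color of \<open>v\<close> is still
  uniform on \<open>A\<close> and avoids the single value \<open>c u\<close> with the claimed
  probability.\<close>

lemma expectation_Pi_pmf_of_set_neq:
  assumes "finite V" "finite A" "A \<noteq> {}" "u \<in> V" "v \<in> V" "u \<noteq> v"
  shows "measure_pmf.expectation (Pi_pmf V d (\<lambda>_. pmf_of_set A)) (\<lambda>c. of_bool (c u \<noteq> c v))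
    = (1 - 1 / card A :: real)"
proof -
  let ?p = "pmf_of_set A" and ?W = "V - {v}"
  let ?Q = "Pi_pmf ?W d (\<lambda>_. ?p)"
  have inner: "measure_pmf.expectation (map_pmf (\<lambda>y. c(v := y)) ?p) (\<lambda>c. of_bool (c u \<noteq> c v))
    = (1 - 1 / card A :: real)" if "c \<in> set_pmf ?Q" for c
  proof -
    \<comment> \<open>As \<open>u\<close> differs from \<open>v\<close>, it lies in
      \<open>?W\<close>, so \<open>c u\<close> is a drawn color and not the default
      \<open>d\<close>.\<close>
    have "c u \<in> A"
      using that assms by (auto simp: set_Pi_pmf PiE_dflt_def)
    have "measure_pmf.expectation (map_pmf (\<lambda>y. c(v := y)) ?p) (\<lambda>c. of_bool (c u \<noteq> c v))
        = (\<Sum>y\<in>A. of_bool (c u \<noteq> y)) / card A"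
      using assms by (simp add: integral_pmf_of_set)
    also have "(\<Sum>y\<in>A. of_bool (c u \<noteq> y)) = (\<Sum>y\<in>A - {c u}. 1 :: real)"
      using assms by (intro sum.mono_neutral_cong_right) auto
    also have "\<dots> = real (card A) - 1"
      using \<open>c u \<in> A\<close> assms card_gt_0_iff[of A] by (simp add: card_Diff_singleton of_nat_diff)
    finally show ?thesis using assms by (simp add: diff_divide_distrib)
  qed
  have "Pi_pmf V d (\<lambda>_. ?p) = Pi_pmf (insert v ?W) d (\<lambda>_. ?p)"
    using assms by (simp add: insert_absorb)
  \<comment> \<open>Swapping the two independent draws makes the color of \<open>v\<close> the last
    one chosen.\<close>
  also have "\<dots> = ?Q \<bind> (\<lambda>c. map_pmf (\<lambda>y. c(v := y)) ?p)"
    using assms by (subst Pi_pmf_insert') (auto simp: map_pmf_def intro: bind_commute_pmf)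
  finally have "measure_pmf.expectation (Pi_pmf V d (\<lambda>_. ?p)) (\<lambda>c. of_bool (c u \<noteq> c v))
    = (\<Sum>c\<in>set_pmf ?Q. pmf ?Q c *\<^sub>R
        measure_pmf.expectation (map_pmf (\<lambda>y. c(v := y)) ?p) (\<lambda>c. of_bool (c u \<noteq> c v) :: real))"
    using assms by (simp only:) (intro pmf_expectation_bind; auto simp: set_Pi_pmf)
  also have "\<dots> = (\<Sum>c\<in>set_pmf ?Q. pmf ?Q c * (1 - 1 / card A))"
    by (intro sum.cong refl) (simp only: inner real_scaleR_def)
  also have "\<dots> = 1 - 1 / card A"
    using assms unfolding sum_distrib_right[symmetric]
    by (subst sum_pmf_eq_1) (auto simp: set_Pi_pmf)
  finally show ?thesis .
qed

context rooted_tree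
begin

lemma par_neq: "v \<in> verts G - {r} \<Longrightarrow> par v \<noteq> v"
  using depth_par[of v] by (metis n_not_Suc_n)

lemma expected_blocks_eq:
  assumes "k \<ge> 1"
  shows "expected_blocks k G = 1 + (real (card (verts G)) - 1) * (1 - 1 / real k)"
proof -
  let ?V = "verts G - {r}"
  \<comment> \<open>Finite support gives the integrability required for linearity of
    expectation.\<close>
  have fin: "finite (set_pmf (random_coloring k G))"
    using assms by (auto simp: random_coloring_def set_Pi_pmf lessThan_empty_iff)
  have card: "real (card (blocks G c)) = 1 + (\<Sum>v\<in>?V. of_bool (c (par v) \<noteq> c v))" for c :: "'a \<Rightarrow> nat"
    by (simp add: card_blocks Int_def eq_commute conj_commute)
  have "expected_blocks k G = 1 + (\<Sum>v\<in>?V.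
      measure_pmf.expectation (random_coloring k G) (\<lambda>c. of_bool (c (par v) \<noteq> c v)))"
    unfolding expected_blocks_def card
    by (simp add: integrable_measure_pmf_finite[OF fin] del: sum_of_bool_eq)
  also have "\<dots> = 1 + (\<Sum>v\<in>?V. 1 - 1 / real k)"
    unfolding random_coloring_def using assms
    by (intro arg_cong2[of _ _ _ _ "(+)"] refl sum.cong, subst expectation_Pi_pmf_of_set_neq)
       (auto simp: par_in_verts par_neq lessThan_empty_iff)
  also have "\<dots> = 1 + (real (card (verts G)) - 1) * (1 - 1 / real k)"
    using root card_gt_0_iff[of "verts G"] by (auto simp: of_nat_diff)
  finally show ?thesis .
qed

end

section \<open>Parent pointers from distances\<close>

text \<open>
  Take a breadth-first spanning tree, i.e. choose for each vertex one neighbour closer to the root.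
  Any two vertices are joined by a walk inside it, and since the graph is acyclic a walk between
  adjacent vertices must use their arc; hence the spanning tree is everything.
\<close>

lemma undirected_tree_imp_rooted_tree:
  assumes T: "undirected_tree G" and r: "r \<in> verts G"
  shows "\<exists>par. rooted_tree G r par (graph_dist G r)"
proof -
  interpret graph G using T by (simp add: undirected_tree_def)
  let ?d = "graph_dist G r"
  have "strongly_connected G"
    using T sym_arcs symmetric_connected_imp_strongly_connected by (simp add: undirected_tree_def)
  then have "\<exists>l p. awalk r p v \<and> length p = l" if "v \<in> verts G" for v
    using that r by (auto simp: reachable_awalk strongly_connected_def)
  then have walk: "\<exists>p. awalk r p v \<and> length p = ?d v" if "v \<in> verts G" for v
    unfolding graph_dist_def using LeastI_ex[of "\<lambda>l. \<exists>p. awalk r p v \<and> length p = l"] that by blast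
  have le: "?d v \<le> length p" if "awalk r p v" for p v
    unfolding graph_dist_def using that by (auto intro: Least_le)
  \<comment> \<open>The witness is the penultimate vertex of a shortest walk from \<open>r\<close>
    to \<open>v\<close>.\<close>
  have "\<exists>u. u \<rightarrow>\<^bsub>G\<^esub> v \<and> ?d v = Suc (?d u)" if v: "v \<in> verts G - {r}" for v
  proof -
    obtain p where p: "awalk r p v" "length p = ?d v" using walk v by auto
    then have "p \<noteq> []" using v by (auto simp: awalk_Nil_iff)
    then obtain q e where q: "p = q @ [e]" by (cases p rule: rev_cases) auto
    then have e: "awalk r q (tail G e)" "e \<in> arcs G" "head G e = v"
      using p(1) by (auto simp: awalk_simps)
    obtain s where s: "awalk r s (tail G e)" "length s = ?d (tail G e)"
      using walk[of "tail G e"] e(2) by auto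
    have "awalk r (s @ [e]) v" using s e by (auto simp: awalk_simps)
    from le[OF this] have "?d v \<le> Suc (?d (tail G e))" using s(2) by simp
    moreover have "Suc (?d (tail G e)) \<le> ?d v" using le[OF e(1)] p q by simp
    moreover have "tail G e \<rightarrow>\<^bsub>G\<^esub> v" using in_arcs_imp_in_arcs_ends[OF e(2)] e(3) by simp
    ultimately show ?thesis by (intro exI[of _ "tail G e"]) simp
  qed
  then obtain par where par: "par v \<rightarrow>\<^bsub>G\<^esub> v" "?d v = Suc (?d (par v))" if "v \<in> verts G - {r}" for v
    by metis
  define P where "P = {(par v, v) | v. v \<in> verts G - {r}}"
  define good where "good p \<longleftrightarrow> (\<forall>e\<in>set p. (tail G e, head G e) \<in> P \<union> P\<inverse>)" for p
  have PG: "P \<union> P\<inverse> \<subseteq> arcs_ends G"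
    using par(1) graph_symmetric by (auto simp: P_def)
  \<comment> \<open>Both directions are kept so that any two vertices can be joined through
    \<open>r\<close> by a good walk.\<close>
  have good: "(\<exists>p. awalk r p v \<and> good p) \<and> (\<exists>p. awalk v p r \<and> good p)" if "v \<in> verts G" for v
    using that
  proof (induction "?d v" arbitrary: v rule: less_induct)
    case less
    show ?case
    proof (cases "v = r")
      case True
      then have "awalk r [] v" "awalk v [] r" "good []" using r by (auto simp: awalk_Nil_iff good_def)
      then show ?thesis by blast
    next
      case False
      then have v: "v \<in> verts G - {r}" using less.prems by simp
      then have "par v \<in> verts G" using par(1) by (meson adj_in_verts(1))
      then obtain p q where pq: "awalk r p (par v)" "good p" "awalk (par v) q r" "good q"
        using less.hyps[of "par v"] par(2)[OF v] by auto
      obtain e e' where e: "e \<in> arcs G" "tail G e = par v" "head G e = v"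
        and e': "e' \<in> arcs G" "tail G e' = v" "head G e' = par v"
        using par(1)[OF v] graph_symmetric[OF par(1)[OF v]] by (auto simp: arcs_ends_conv)
      have "awalk r (p @ [e]) v" "awalk v (e' # q) r"
        using pq e e' by (auto simp: awalk_simps)
      moreover have "good (p @ [e])" "good (e' # q)"
        using pq e e' v by (auto simp: good_def P_def)
      ultimately show ?thesis by blast
    qed
  qed
  have "(u, v) \<in> P \<union> P\<inverse>" if uv: "u \<rightarrow>\<^bsub>G\<^esub> v" for u v
  proof -
    obtain p q where "awalk u p r" "awalk r q v" and pq: "good p" "good q"
      using good uv by (meson adj_in_verts)
    then have "awalk u (p @ q) v" by auto
    then obtain e where "e \<in> set (p @ q)" "tail G e = u" "head G e = v"
      using undirected_tree_awalk_uses_arc[OF T uv] by blast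
    then show ?thesis using pq by (auto simp: good_def)
  qed
  then have "arcs_ends G = P \<union> P\<inverse>" using PG by auto
  then have "rooted_tree G r par ?d"
    using r par(1) par(2) by unfold_locales (auto simp: P_def dest: adj_in_verts(1))
  then show ?thesis by (rule exI[of _ par])
qed

section \<open>Size of a perfect binary tree\<close>

text \<open>Levels double in size down to depth \<open>n\<close>, where all leaves lie; the total is
  a geometric sum.\<close>

lemma perfect_binary_tree_card_verts:
  assumes "perfect_binary_tree G r n"
  shows "card (verts G) = 2 ^ Suc n - 1"
proof -
  let ?d = "graph_dist G r"
  obtain par where "rooted_tree G r par ?d"
    using assms undirected_tree_imp_rooted_tree[of G r] by (auto simp: perfect_binary_tree_def)
  then interpret rooted_tree G r par ?d .
  \<comment> \<open>A neighbor that is the parent of \<open>u\<close> is ruled out because its depth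
    is smaller.\<close>
  have children: "children G r u = {v \<in> verts G - {r}. par v = u}" if "u \<in> verts G" for u
    using depth_par by (auto simp: children_def adj_iff)
  have d0: "?d r = 0"
    unfolding graph_dist_def using root by (intro Least_eq_0) (auto simp: awalk_Nil_iff)
  have leaf: "?d u = n" if "u \<in> verts G" "children G r u = {}" for u
    using assms that by (auto simp: perfect_binary_tree_def)
  \<comment> \<open>A vertex of maximal depth has no children, so it is a leaf and the maximal depth
    is \<open>n\<close>.\<close>
  have le_n: "?d v \<le> n" if "v \<in> verts G" for v
  proof -
    define m where "m = Max (?d ` verts G)"
    have "m \<in> ?d ` verts G" using root by (auto simp: m_def intro!: Max_in)
    then obtain u where u: "u \<in> verts G" "?d u = m" by auto
    have max: "?d w \<le> m" if "w \<in> verts G" for w using that by (simp add: m_def)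
    have "children G r u = {}"
      using max depth_par u by (fastforce simp: children)
    then show ?thesis using leaf u max that by metis
  qed
  define L where "L i = {v \<in> verts G. ?d v = i}" for i
  have cardL: "card (L i) = 2 ^ i" if "i \<le> n" for i
    using that
  proof (induction i)
    case 0
    have "L 0 = {r}" using root d0 depth_par by (fastforce simp: L_def)
    then show ?case by simp
  next
    case (Suc i)
    \<comment> \<open>By \<open>d0\<close> no vertex of positive depth is the root, so each one has
      a parent one level up.\<close>
    have "L (Suc i) = (\<Union>u\<in>L i. children G r u)"
      using d0 depth_par par_in_verts by (fastforce simp: L_def children)
    moreover have "card (\<Union>u\<in>L i. children G r u) = (\<Sum>u\<in>L i. card (children G r u))"
      by (intro card_UN_disjoint) (auto simp: L_def children)
    moreover have "card (children G r u) = 2" if "u \<in> L i" for u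
    proof -
      have u: "u \<in> verts G" "?d u = i" using that by (auto simp: L_def)
      then have "children G r u \<noteq> {}" using leaf[of u] Suc.prems by auto
      then have "card (children G r u) \<noteq> 0" using u by (simp add: children)
      then show ?thesis using assms u by (auto simp: perfect_binary_tree_def)
    qed
    ultimately show ?case using Suc by simp
  qed
  have "verts G = (\<Union>i\<le>n. L i)" using le_n by (auto simp: L_def)
  then have "card (verts G) = card (\<Union>i\<le>n. L i)" by simp
  also have "\<dots> = (\<Sum>i\<le>n. card (L i))"
    by (intro card_UN_disjoint) (auto simp: L_def)
  also have "\<dots> = (\<Sum>i<Suc n. 2 ^ i)" by (simp add: cardL lessThan_Suc_atMost)
  also have "\<dots> = 2 ^ Suc n - 1" using mask_eq_sum_exp_nat[of "Suc n"] by (simp add: lessThan_def)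
  finally show ?thesis .
qed

theorem corollary2p2:
  fixes B :: "('a, 'b) pre_digraph" and r :: 'a and k n :: nat
  assumes "k \<ge> 1"
    and "perfect_binary_tree B r n"
  shows "expected_blocks k B = (real k + 2 * (real k - 1) * (2 ^ n - 1)) / real k"
proof -
  obtain par where "rooted_tree B r par (graph_dist B r)"
    using assms(2) undirected_tree_imp_rooted_tree[of B r] by (auto simp: perfect_binary_tree_def)
  then have "expected_blocks k B = 1 + (real (card (verts B)) - 1) * (1 - 1 / real k)"
    using assms(1) by (rule rooted_tree.expected_blocks_eq)
  also have "real (card (verts B)) = 2 * 2 ^ n - 1"
    using perfect_binary_tree_card_verts[OF assms(2)] by (simp add: of_nat_diff)
  finally show ?thesis using assms(1) by (simp add: field_simps)
qed

end
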